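(* Let the function $T^F_\Omega$ be convex, and let $\bar x\notin\Omega$ be such that $r:=T^F_\Omega(\bar x)<\infty$ and $\Pi^F_\Omega(\bar x)\ne\emptyset$. Then for any $\bar w\in\Pi^F_\Omega(\bar x)$ we have $$\partial T^F_\Omega(\bar x)=N(\bar x;\Omega_r)\cap\big[-\partial\rho_F(\bar w-\bar x)\big]\subset N(\bar w;\Omega)\cap\big[-\partial\rho_F(\bar w-\bar x)\big].$$ If in addition $0\in F$, then the inclusion holds as an equality, and thus $$\partial T^F_\Omega(\bar x)=N(\bar w;\Omega)\cap\big[-\partial\rho_F(\bar w-\bar x)\big].$$
   Context: $X$ is an arbitrary (real) Banach space with topological dual $X^*$ and pairing $\langle\cdot,\cdot\rangle$. Standing assumptions: $\Omega\subset X$ is nonempty and closed; $F\subset X$ is nonempty, closed, bounded and convex (it is not assumed that $0\in\mathrm{int}\,F$). The minimal time function is $T^F_\Omega(x):=\inf\{t\ge 0\mid \Omega\cap(x+tF)\ne\emptyset\}\in[0,\infty]$ and the Minkowski gauge is $\rho_F(u):=\inf\{t\ge0\mid u\in tF\}\in[0,\infty]$, with $\inf\emptyset=\infty$. (Convexity of $T^F_\Omega$ is equivalent to convexity of $\Omega$.) For $r>0$, $\Omega_r:=\{x\in X\mid T^F_\Omega(x)\le r\}$. For $x$ with $T^F_\Omega(x)<\infty$ the (generalized) projection is $\Pi^F_\Omega(x):=(x+T^F_\Omega(x)F)\cap\Omega$. Here $\partial$ and $N$ are the subdifferential and normal cone of convex analysis: for convex $\varphi:X\to(-\infty,\infty]$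 with $\varphi(\bar x)<\infty$, $\partial\varphi(\bar x)=\{x^*\in X^*\mid\langle x^*,x-\bar x\rangle\le\varphi(x)-\varphi(\bar x)\text{ for all }x\in X\}$; for a convex set $\Theta$ and $\bar x\in\Theta$, $N(\bar x;\Theta)=\{x^*\in X^*\mid\langle x^*,x-\bar x\rangle\le0\text{ for all }x\in\Theta\}$. For $A\subset X^*$, $-A:=\{-a\mid a\in A\}$. *)

theory Defs
  imports "HOL-Analysis.Analysis"
begin

text \<open>
  The topological dual of a real Banach space \<open>'a\<close> is the type \<open>'a \<Rightarrow>\<^sub>L real\<close> of bounded linear
  functionals; the pairing is function application.  Extended-real-valued functions take values
  in \<^typ>\<open>ereal\<close>, where \<open>Inf {} = \<infinity>\<close>.
\<close>

definition minimal_time :: "'a::real_normed_vector set \<Rightarrow> 'a set \<Rightarrow> 'a \<Rightarrow> ereal" where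
  "minimal_time F \<Omega> x =
     Inf {ereal t | t. t \<ge> 0 \<and> \<Omega> \<inter> (\<lambda>f. x + t *\<^sub>R f) ` F \<noteq> {}}"

definition minkowski_gauge :: "'a::real_normed_vector set \<Rightarrow> 'a \<Rightarrow> ereal" where
  "minkowski_gauge F u = Inf {ereal t | t. t \<ge> 0 \<and> u \<in> (\<lambda>f. t *\<^sub>R f) ` F}"

definition enlargement :: "'a::real_normed_vector set \<Rightarrow> 'a set \<Rightarrow> real \<Rightarrow> 'a set" where
  "enlargement F \<Omega> r = {x. minimal_time F \<Omega> x \<le> ereal r}"

text \<open>
  Only meaningful where the minimal time is finite, since \<^const>\<open>real_of_ereal\<close> sends \<open>\<infinity>\<close> to \<open>0\<close>.
\<close>

definition gen_projection :: "'a::real_normed_vector set \<Rightarrow> 'a set \<Rightarrow> 'a \<Rightarrow> 'a set" where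
  "gen_projection F \<Omega> x = (\<lambda>f. x + real_of_ereal (minimal_time F \<Omega> x) *\<^sub>R f) ` F \<inter> \<Omega>"

text \<open>
  Convexity of functions with values in \<open>(-\<infinity>, \<infinity>]\<close>; the library's \<^const>\<open>convex_on\<close> covers
  real-valued functions only.
\<close>

definition convex_ereal :: "('a::real_vector \<Rightarrow> ereal) \<Rightarrow> bool" where
  "convex_ereal \<phi> \<longleftrightarrow>
     (\<forall>x y. \<forall>t\<in>{0<..<1}.
        \<phi> (t *\<^sub>R x + (1 - t) *\<^sub>R y) \<le> ereal t * \<phi> x + ereal (1 - t) * \<phi> y)"

text \<open>Only meaningful for convex \<open>\<phi>\<close> with values in \<open>(-\<infinity>, \<infinity>]\<close> and at points where \<open>\<phi>\<close> is finite.\<close>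

definition subdifferential ::
    "('a::real_normed_vector \<Rightarrow> ereal) \<Rightarrow> 'a \<Rightarrow> ('a \<Rightarrow>\<^sub>L real) set" where
  "subdifferential \<phi> a = {p. \<forall>x. ereal (blinfun_apply p (x - a)) \<le> \<phi> x - \<phi> a}"

text \<open>Only meaningful for convex \<open>\<Theta>\<close> and \<open>a \<in> \<Theta>\<close>.\<close>

definition normal_cone :: "'a::real_normed_vector \<Rightarrow> 'a set \<Rightarrow> ('a \<Rightarrow>\<^sub>L real) set" where
  "normal_cone a \<Theta> = {p. \<forall>x\<in>\<Theta>. blinfun_apply p (x - a) \<le> 0}"

end

theory Submission
  imports Defs
begin

text \<open>
  The three sets of functionals in the theorem form a cycle of inclusions
  \<open>\<partial>T(x) \<subseteq> N(x;\<Omega>\<^sub>r) \<inter> [-\<partial>\<rho>(w - x)] \<subseteq> N(w;\<Omega>) \<inter> [-\<partial>\<rho>(w - x)] \<subseteq> \<partial>T(x)\<close>,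
  where \<open>T\<close> is the minimal time function and \<open>\<rho>\<close> the gauge of \<open>F\<close>, so they all coincide.

  A point that reaches \<open>\<Omega>\<close> at \<open>w\<close> needs at least the minimal time, that is
  \<open>T (w - u) \<le> \<rho> u\<close> for every \<open>u\<close>, and a projection \<open>w\<close> of \<open>x\<close> is a point where this becomes
  the equality \<open>T x = \<rho> (w - x) = r\<close>. Hence every affine minorant of \<open>T\<close> that is exact at \<open>x\<close>
  turns, under the reflection \<open>u \<mapsto> w - u\<close>, into an affine minorant of \<open>\<rho>\<close> that is exact at
  \<open>w - x\<close>. This gives the first inclusion, as subgradients are normal to sublevel sets. The
  second one comes from the translation by \<open>x - w\<close>: it carries \<open>w\<close> to \<open>x\<close> and, since
  \<open>w - x \<in> r F\<close>, carries \<open>\<Omega>\<close> into the enlargement \<open>\<Omega>\<^sub>r\<close>.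

  The last inclusion rests on the dual description of \<open>\<partial>\<rho>\<close>: by positive homogeneity, a subgradient
  \<open>q\<close> of \<open>\<rho>\<close> at \<open>v\<close> is at most 1 on \<open>F\<close> and satisfies \<open>q v \<ge> \<rho> v\<close>. If a trajectory takes \<open>y\<close> to
  \<open>y + s f \<in> \<Omega>\<close> in time \<open>s\<close>, then travelling from \<open>x\<close> to \<open>w\<close>, from \<open>w\<close> to \<open>y + s f\<close> and back to
  \<open>y\<close> changes \<open>p = -q\<close> by at most \<open>-r\<close>, \<open>0\<close> and \<open>s\<close> respectively. So \<open>p (y - x) \<le> s - r\<close>, and the
  infimum over \<open>s\<close> is the subgradient inequality for \<open>T\<close>.
\<close>

lemma minimal_time_le:
  assumes "t \<ge> 0" "f \<in> F" "y + t *\<^sub>R f \<in> \<Omega>"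
  shows "minimal_time F \<Omega> y \<le> ereal t"
  unfolding minimal_time_def using assms by (intro Inf_lower) blast

lemma minkowski_gauge_le:
  assumes "t \<ge> 0" "f \<in> F"
  shows "minkowski_gauge F (t *\<^sub>R f) \<le> ereal t"
  unfolding minkowski_gauge_def using assms by (intro Inf_lower) blast

text \<open>
  Any way of writing \<open>u\<close> as \<open>t f\<close> with \<open>f \<in> F\<close> is a trajectory from \<open>w - u\<close> to the point
  \<open>w\<close> of the target.
\<close>
lemma minimal_time_le_minkowski_gauge:
  assumes "w \<in> \<Omega>"
  shows "minimal_time F \<Omega> (w - u) \<le> minkowski_gauge F u"
  unfolding minkowski_gauge_def
proof (rule Inf_greatest)
  fix e assume "e \<in> {ereal t | t. t \<ge> 0 \<and> u \<in> (\<lambda>f. t *\<^sub>R f) ` F}"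
  then obtain t f where "e = ereal t" "t \<ge> 0" "f \<in> F" "u = t *\<^sub>R f" by blast
  then show "minimal_time F \<Omega> (w - u) \<le> e"
    using minimal_time_le[of t f F "w - u" \<Omega>] assms by simp
qed

lemma minimal_time_nonneg: "0 \<le> minimal_time F \<Omega> x"
  unfolding minimal_time_def by (rule Inf_greatest) auto

lemma gen_projectionE:
  assumes "minimal_time F \<Omega> x = ereal r" "w \<in> gen_projection F \<Omega> x"
  obtains f where "f \<in> F" "w = x + r *\<^sub>R f" "w \<in> \<Omega>" "r \<ge> 0"
proof -
  have "r \<ge> 0"
    using minimal_time_nonneg[of F \<Omega> x] assms(1) by simp
  then show thesis
    using assms that unfolding gen_projection_def by auto
qed

lemma minkowski_gauge_projection:
  assumes "minimal_time F \<Omega> x = ereal r" "w \<in> gen_projection F \<Omega> x"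
  shows "minkowski_gauge F (w - x) = ereal r"
proof -
  obtain f where f: "f \<in> F" "w = x + r *\<^sub>R f" "w \<in> \<Omega>" "r \<ge> 0"
    using gen_projectionE[OF assms] .
  show ?thesis
  proof (rule antisym)
    show "minkowski_gauge F (w - x) \<le> ereal r"
      using minkowski_gauge_le[of r f F] f by simp
    show "ereal r \<le> minkowski_gauge F (w - x)"
      using minimal_time_le_minkowski_gauge[OF f(3), of F "w - x"] assms(1) by simp
  qed
qed

lemma subdifferential_ereal_iff:
  assumes "\<phi> a = ereal r"
  shows "p \<in> subdifferential \<phi> a \<longleftrightarrow> (\<forall>x. ereal (blinfun_apply p (x - a) + r) \<le> \<phi> x)"
proof -
  have "ereal b \<le> e - ereal r \<longleftrightarrow> ereal (b + r) \<le> e" for b e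
    by (cases e) auto
  then show ?thesis
    unfolding subdifferential_def using assms by simp
qed

lemma mem_uminus_image_iff:
  fixes p :: "'a::group_add"
  shows "p \<in> uminus ` S \<longleftrightarrow> - p \<in> S"
  by (metis image_iff minus_minus)

text \<open>
  The subgradient inequality is tested along the rays \<open>t f\<close>, where the gauge is at most \<open>t\<close>:
  \<open>t = 0\<close> gives the value at \<open>v\<close>, and \<open>t \<rightarrow> \<infinity>\<close> gives the bound on \<open>F\<close>.
\<close>
lemma subgradient_minkowski_gauge:
  assumes q: "q \<in> subdifferential (minkowski_gauge F) v"
    and v: "minkowski_gauge F v = ereal r" and f: "f \<in> F"
  shows "blinfun_apply q f \<le> 1" and "r \<le> blinfun_apply q v"
proof -
  have ray: "t * (blinfun_apply q f - 1) \<le> blinfun_apply q v - r" if "t \<ge> 0" for t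
  proof -
    have "ereal (blinfun_apply q (t *\<^sub>R f - v) + r) \<le> minkowski_gauge F (t *\<^sub>R f)"
      using q unfolding subdifferential_ereal_iff[where \<phi> = "minkowski_gauge F", OF v] by blast
    also have "\<dots> \<le> ereal t"
      using minkowski_gauge_le[OF that f] .
    finally show ?thesis
      by (simp add: blinfun.diff_right blinfun.scaleR_right algebra_simps)
  qed
  show "r \<le> blinfun_apply q v"
    using ray[of 0] by simp
  show "blinfun_apply q f \<le> 1"
  proof (rule ccontr)
    assume "\<not> blinfun_apply q f \<le> 1"
    then have pos: "blinfun_apply q f - 1 > 0" by simp
    then obtain n :: nat where "blinfun_apply q v - r < real n * (blinfun_apply q f - 1)"
      using reals_Archimedean3 by blast
    then show False using ray[of "real n"] by simp
  qed
qed

lemma subdifferential_minimal_time_subset_normal_cone: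
  assumes "minimal_time F \<Omega> x = ereal r"
  shows "subdifferential (minimal_time F \<Omega>) x \<subseteq> normal_cone x (enlargement F \<Omega> r)"
proof
  fix p assume p: "p \<in> subdifferential (minimal_time F \<Omega>) x"
  have "blinfun_apply p (y - x) \<le> 0" if "minimal_time F \<Omega> y \<le> ereal r" for y
  proof -
    have "ereal (blinfun_apply p (y - x) + r) \<le> minimal_time F \<Omega> y"
      using p unfolding subdifferential_ereal_iff[where \<phi> = "minimal_time F \<Omega>", OF assms] by blast
    also note that
    finally show ?thesis by simp
  qed
  then show "p \<in> normal_cone x (enlargement F \<Omega> r)"
    unfolding normal_cone_def enlargement_def by blast
qed

lemma subdifferential_minimal_time_subset_gauge:
  assumes x: "minimal_time F \<Omega> x = ereal r" and w: "w \<in> gen_projection F \<Omega> x"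
  shows "subdifferential (minimal_time F \<Omega>) x
           \<subseteq> uminus ` subdifferential (minkowski_gauge F) (w - x)"
proof
  fix p assume p: "p \<in> subdifferential (minimal_time F \<Omega>) x"
  have "w \<in> \<Omega>" using w unfolding gen_projection_def by blast
  have "ereal (blinfun_apply (- p) (u - (w - x)) + r) \<le> minkowski_gauge F u" for u
  proof -
    have "blinfun_apply (- p) (u - (w - x)) = blinfun_apply p ((w - u) - x)"
      by (simp add: blinfun.minus_left blinfun.diff_right)
    moreover have "ereal (blinfun_apply p ((w - u) - x) + r) \<le> minimal_time F \<Omega> (w - u)"
      using p unfolding subdifferential_ereal_iff[where \<phi> = "minimal_time F \<Omega>", OF x] by blast
    ultimately show ?thesis
      using minimal_time_le_minkowski_gauge[OF \<open>w \<in> \<Omega>\<close>, of F u] by simp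
  qed
  then show "p \<in> uminus ` subdifferential (minkowski_gauge F) (w - x)"
    unfolding mem_uminus_image_iff
      subdifferential_ereal_iff[where \<phi> = "minkowski_gauge F", OF minkowski_gauge_projection[OF x w]] by blast
qed

text \<open>
  Translating \<open>\<Omega>\<close> by \<open>x - w = - r f\<close> lands in the enlargement, since the motion \<open>r f\<close> leads back.
\<close>
lemma normal_cone_enlargement_subset:
  assumes "minimal_time F \<Omega> x = ereal r" and "w \<in> gen_projection F \<Omega> x"
  shows "normal_cone x (enlargement F \<Omega> r) \<subseteq> normal_cone w \<Omega>"
proof
  fix p assume p: "p \<in> normal_cone x (enlargement F \<Omega> r)"
  obtain f where f: "f \<in> F" "w = x + r *\<^sub>R f" "r \<ge> 0"
    using gen_projectionE[OF assms] by metis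
  have "blinfun_apply p (z - w) \<le> 0" if "z \<in> \<Omega>" for z
  proof -
    have "z - r *\<^sub>R f \<in> enlargement F \<Omega> r"
      using minimal_time_le[of r f F "z - r *\<^sub>R f" \<Omega>] f that unfolding enlargement_def by simp
    then have "blinfun_apply p ((z - r *\<^sub>R f) - x) \<le> 0"
      using p unfolding normal_cone_def by blast
    then show ?thesis
      using f(2) by (simp add: algebra_simps)
  qed
  then show "p \<in> normal_cone w \<Omega>"
    unfolding normal_cone_def by blast
qed

text \<open>
  This inclusion closes the cycle. The increment of \<open>p\<close> from \<open>x\<close> to \<open>y\<close> is split along the path
  through \<open>w\<close> and an arbitrary point \<open>y + s f\<close> of \<open>\<Omega>\<close>.
\<close>
lemma normal_cone_inter_gauge_subset_subdifferential:
  assumes x: "minimal_time F \<Omega> x = ereal r" and w: "w \<in> gen_projection F \<Omega> x"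
  shows "normal_cone w \<Omega> \<inter> uminus ` subdifferential (minkowski_gauge F) (w - x)
           \<subseteq> subdifferential (minimal_time F \<Omega>) x"
proof
  fix p assume p: "p \<in> normal_cone w \<Omega> \<inter> uminus ` subdifferential (minkowski_gauge F) (w - x)"
  then have "- p \<in> subdifferential (minkowski_gauge F) (w - x)"
    unfolding mem_uminus_image_iff[symmetric] by blast
  note q = subgradient_minkowski_gauge[OF this minkowski_gauge_projection[OF x w],
      unfolded blinfun.minus_left]
  have "ereal (blinfun_apply p (y - x) + r) \<le> minimal_time F \<Omega> y" for y
    unfolding minimal_time_def
  proof (rule Inf_greatest)
    fix e assume "e \<in> {ereal t | t. t \<ge> 0 \<and> \<Omega> \<inter> (\<lambda>f. y + t *\<^sub>R f) ` F \<noteq> {}}"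
    then obtain s f where sf: "e = ereal s" "s \<ge> 0" "f \<in> F" "y + s *\<^sub>R f \<in> \<Omega>" by blast
    have "y - x = (w - x) + ((y + s *\<^sub>R f) - w) - s *\<^sub>R f" by simp
    then have "blinfun_apply p (y - x)
        = blinfun_apply p (w - x) + blinfun_apply p ((y + s *\<^sub>R f) - w) - s * blinfun_apply p f"
      by (simp only: blinfun.add_right blinfun.diff_right blinfun.scaleR_right real_scaleR_def)
    moreover have "blinfun_apply p (w - x) \<le> - r"
      using q(2)[OF sf(3)] by simp
    moreover have "blinfun_apply p ((y + s *\<^sub>R f) - w) \<le> 0"
      using p sf(4) unfolding normal_cone_def by blast
    moreover have "s * (- blinfun_apply p f) \<le> s * 1"
      using q(1)[OF sf(3)] sf(2) by (rule mult_left_mono)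
    ultimately show "ereal (blinfun_apply p (y - x) + r) \<le> e"
      using sf(1) by simp
  qed
  then show "p \<in> subdifferential (minimal_time F \<Omega>) x"
    unfolding subdifferential_ereal_iff[where \<phi> = "minimal_time F \<Omega>", OF x] by blast
qed

theorem theorem7p3:
  fixes \<Omega> F :: "'a::banach set" and x :: 'a and r :: real
  assumes "\<Omega> \<noteq> {}" and "closed \<Omega>"
    and "F \<noteq> {}" and "closed F" and "bounded F" and "convex F"
    and "convex_ereal (minimal_time F \<Omega>)"
    and "x \<notin> \<Omega>"
    and "minimal_time F \<Omega> x = ereal r"
    and "gen_projection F \<Omega> x \<noteq> {}"
  shows "\<forall>w \<in> gen_projection F \<Omega> x.
      subdifferential (minimal_time F \<Omega>) x =
        normal_cone x (enlargement F \<Omega> r) \<inter> uminus ` subdifferential (minkowski_gauge F) (w - x) \<and>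
      normal_cone x (enlargement F \<Omega> r) \<inter> uminus ` subdifferential (minkowski_gauge F) (w - x)
        \<subseteq> normal_cone w \<Omega> \<inter> uminus ` subdifferential (minkowski_gauge F) (w - x) \<and>
      (0 \<in> F \<longrightarrow>
        normal_cone x (enlargement F \<Omega> r) \<inter> uminus ` subdifferential (minkowski_gauge F) (w - x)
          = normal_cone w \<Omega> \<inter> uminus ` subdifferential (minkowski_gauge F) (w - x) \<and>
        subdifferential (minimal_time F \<Omega>) x =
          normal_cone w \<Omega> \<inter> uminus ` subdifferential (minkowski_gauge F) (w - x))"
proof
  fix w assume w: "w \<in> gen_projection F \<Omega> x"
  note x = \<open>minimal_time F \<Omega> x = ereal r\<close>
  let ?T = "subdifferential (minimal_time F \<Omega>) x"
  let ?G = "uminus ` subdifferential (minkowski_gauge F) (w - x)"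
  have "?T \<subseteq> normal_cone x (enlargement F \<Omega> r) \<inter> ?G"
    using subdifferential_minimal_time_subset_normal_cone[OF x]
      subdifferential_minimal_time_subset_gauge[OF x w] by blast
  moreover have "normal_cone x (enlargement F \<Omega> r) \<inter> ?G \<subseteq> normal_cone w \<Omega> \<inter> ?G"
    using normal_cone_enlargement_subset[OF x w] by blast
  moreover have "normal_cone w \<Omega> \<inter> ?G \<subseteq> ?T"
    using normal_cone_inter_gauge_subset_subdifferential[OF x w] .
  ultimately show "?T = normal_cone x (enlargement F \<Omega> r) \<inter> ?G \<and>
      normal_cone x (enlargement F \<Omega> r) \<inter> ?G \<subseteq> normal_cone w \<Omega> \<inter> ?G \<and>
      (0 \<in> F \<longrightarrow>
        normal_cone x (enlargement F \<Omega> r) \<inter> ?G = normal_cone w \<Omega> \<inter> ?G \<and>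
        ?T = normal_cone w \<Omega> \<inter> ?G)"
    by blast
qed

end
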